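(* Let $Q=\prod_{j=1}^n(a_j,b_j)\subset\mathbb R^n$ with $a_j<b_j$, and let $h:\mathbb D\to Q$ be harmonic. Then $$\mathcal F_Q(h(z);dh_z\xi)\le\frac{2|\xi|}{1-|z|^2}$$ for every $z\in\mathbb D$ and every tangent vector $\xi\in T_z\mathbb D$. Consequently, $d_Q(h(z_0),h(z_1))\le d_{\mathbb D}(z_0,z_1)$ for all $z_0,z_1\in\mathbb D$. The constant in the infinitesimal inequality is sharp (the right-hand side cannot be multiplied by a constant smaller than $1$ so that the inequality remains valid for all harmonic $h:\mathbb D\to Q$, all $z$ and all $\xi$).
   Context: $\mathbb D=\{z\in\mathbb C:|z|<1\}$; maps into $\mathbb R^n$ are harmonic if each component is. For $p\in Q$ and $v\in\mathbb R^n$, $$\mathcal F_Q(p;v)=\max_{1\le j\le n}\frac{2|v_j|}{A_j(p_j)},\qquad A_j(p_j)=\frac{2(b_j-a_j)}{\pi}\sin\frac{\pi(p_j-a_j)}{b_j-a_j}.$$ $d_Q$ is the path distance on $Q$ induced by $\mathcal F_Q$ (infimum of $\int\mathcal F_Q(\gamma;\gamma')\,ds$ over piecewise $C^1$ curves joining the points), and $d_{\mathbb D}$ is the Poincaré distance on $\mathbb D$ induced by the curvature $-1$ density $2/(1-|z|^2)$. *)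

theory Defs
  imports "HOL-Analysis.Analysis"
begin

definition dir_deriv :: "complex \<Rightarrow> (complex \<Rightarrow> real) \<Rightarrow> complex \<Rightarrow> real" where
  "dir_deriv v u z = frechet_derivative u (at z) v"

text \<open>
  \<open>dir_deriv 1\<close> and \<open>dir_deriv \<i>\<close> are the two partial derivatives; the sets below are always open.
\<close>

definition C1_on :: "(complex \<Rightarrow> real) \<Rightarrow> complex set \<Rightarrow> bool" where
  "C1_on u S \<longleftrightarrow> (\<forall>z\<in>S. u differentiable (at z)) \<and>
     (\<forall>v\<in>{1, \<i>}. continuous_on S (dir_deriv v u))"

definition C2_on :: "(complex \<Rightarrow> real) \<Rightarrow> complex set \<Rightarrow> bool" where
  "C2_on u S \<longleftrightarrow> C1_on u S \<and> (\<forall>v\<in>{1, \<i>}. C1_on (dir_deriv v u) S)"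

definition harmonic_on :: "(complex \<Rightarrow> real) \<Rightarrow> complex set \<Rightarrow> bool" where
  "harmonic_on u S \<longleftrightarrow> C2_on u S \<and>
     (\<forall>z\<in>S. dir_deriv 1 (dir_deriv 1 u) z + dir_deriv \<i> (dir_deriv \<i> u) z = 0)"

definition harmonic_map_on :: "(complex \<Rightarrow> real ^ 'n) \<Rightarrow> complex set \<Rightarrow> bool" where
  "harmonic_map_on h S \<longleftrightarrow> (\<forall>j. harmonic_on (\<lambda>z. h z $ j) S)"

definition A_coeff :: "real \<Rightarrow> real \<Rightarrow> real \<Rightarrow> real" where
  "A_coeff \<alpha> \<beta> t = 2 * (\<beta> - \<alpha>) / pi * sin (pi * (t - \<alpha>) / (\<beta> - \<alpha>))"

definition box_metric :: "real ^ 'n \<Rightarrow> real ^ 'n \<Rightarrow> real ^ 'n \<Rightarrow> real ^ 'n \<Rightarrow> real" where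
  "box_metric a b p v = Max (range (\<lambda>j. 2 * \<bar>v $ j\<bar> / A_coeff (a $ j) (b $ j) (p $ j)))"

definition poincare_metric :: "complex \<Rightarrow> complex \<Rightarrow> real" where
  "poincare_metric z \<xi> = 2 * norm \<xi> / (1 - (norm z)\<^sup>2)"

text \<open>
  The library's \<open>valid_path\<close> only asks for a continuous derivative off a finite set, where it may
  be unbounded, so such a curve can have infinite length (and then the total function \<open>integral\<close>
  would return 0).  Here each closed piece, between consecutive points \<open>s < t\<close> of the partition
  \<open>T\<close>, is continuously differentiable up to its end points, with one-sided derivatives there.
\<close>

definition piecewise_C1_curve :: "(real \<Rightarrow> 'a::real_normed_vector) \<Rightarrow> bool" where
  "piecewise_C1_curve \<gamma> \<longleftrightarrow> continuous_on {0..1} \<gamma> \<and>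
     (\<exists>T. finite T \<and> {0, 1} \<subseteq> T \<and> T \<subseteq> {0..1} \<and>
        (\<forall>s\<in>T. \<forall>t\<in>T. s < t \<and> T \<inter> {s<..<t} = {} \<longrightarrow>
           (\<exists>D. continuous_on {s..t} D \<and>
              (\<forall>x\<in>{s..t}. (\<gamma> has_vector_derivative D x) (at x within {s..t})))))"

text \<open>
  For a piecewise C1 curve \<open>vector_derivative \<gamma> (at s)\<close> is the derivative except at finitely many
  \<open>s\<close>, which do not affect the integral.
\<close>

definition curve_length :: "('a::real_normed_vector \<Rightarrow> 'a \<Rightarrow> real) \<Rightarrow> (real \<Rightarrow> 'a) \<Rightarrow> real" where
  "curve_length F \<gamma> = integral {0..1} (\<lambda>s. F (\<gamma> s) (vector_derivative \<gamma> (at s)))"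

definition path_distance ::
  "('a::real_normed_vector \<Rightarrow> 'a \<Rightarrow> real) \<Rightarrow> 'a set \<Rightarrow> 'a \<Rightarrow> 'a \<Rightarrow> real" where
  "path_distance F S x y =
     Inf (curve_length F ` {\<gamma>. piecewise_C1_curve \<gamma> \<and> path_image \<gamma> \<subseteq> S \<and>
                               pathstart \<gamma> = x \<and> pathfinish \<gamma> = y})"

definition box_dist :: "real ^ 'n \<Rightarrow> real ^ 'n \<Rightarrow> real ^ 'n \<Rightarrow> real ^ 'n \<Rightarrow> real" where
  "box_dist a b = path_distance (box_metric a b) (box a b)"

definition poincare_dist :: "complex \<Rightarrow> complex \<Rightarrow> real" where
  "poincare_dist = path_distance poincare_metric (ball 0 1)"

end

theory Submission
  imports Defs "HOL-Complex_Analysis.Riemann_Mapping"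
begin

text \<open>
  Each component of a harmonic map into the box is the real part of a holomorphic map into a vertical
  strip, and \<open>2 / A_coeff\<close> is the hyperbolic density of that strip, so the infinitesimal inequality is
  Schwarz--Pick together with \<open>|Re w| \<le> |w|\<close>. Integrating along curves gives the
  inequality of distances, and conformal maps onto the strips give equality at the origin.
\<close>

subsection \<open>Symmetry of second derivatives\<close>

text \<open>If \<open>u\<close> is the real part of a holomorphic \<open>f\<close>, then f' has real
  part \<open>dir_deriv 1 u\<close> and imaginary part \<open>- dir_deriv \<i> u\<close>.
  Conversely, one Cauchy-Riemann equation for this function is the Laplace equation and the other is
  the equality of the mixed derivatives of \<open>u\<close>; hence the symmetry result. The sine in
  \<open>A_coeff\<close> comes from the exponential: pulling the half-plane density |dw| / Im w back
  under w = exp (\<i> k (s - \<alpha>)) with k = pi / (\<beta> - \<alpha>) gives k / sin (k (Re s -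
  \<alpha>)), which is \<open>2 / A_coeff\<close> at Re s. For lengths the obstacle is that
  \<open>integral\<close> is 0 on non-integrable functions, which could make a length too small.
  Only the Poincare length is on the larger side, so its integrand is the one proved integrable.
  Equality at the origin requires that passing to the real part loses nothing, so the tangent vector
  is chosen to make f' \<xi> real.\<close>

text \<open>The mean value theorem along \<open>v\<close> turns the second difference into
  \<open>t\<close> times an increment of the directional derivative between two points that differ
  by \<open>t *\<^sub>R w\<close>. Linearising that derivative at \<open>z\<close> makes the
  increment \<open>t * L w\<close> up to o(t).\<close>

lemma second_difference_tendsto:
  fixes u :: "'a::real_normed_vector \<Rightarrow> real"
  assumes "open S" "z \<in> S"
    and u: "\<And>x. x \<in> S \<Longrightarrow> (u has_derivative u' x) (at x)"
    and G: "((\<lambda>x. u' x v) has_derivative L) (at z)"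
  shows "((\<lambda>t. (u (z + t *\<^sub>R v + t *\<^sub>R w) - u (z + t *\<^sub>R v) - u (z + t *\<^sub>R w) + u z) / t\<^sup>2)
            \<longlongrightarrow> L w) (at_right 0)"
proof (rule tendstoI)
  fix e :: real assume "e > 0"
  \<comment> \<open>\<open>M\<close> is chosen so that the two displacements \<open>A\<close> and
    \<open>B\<close> below satisfy norm A + norm B <= t * M; the summand 1 keeps it positive. With
    \<open>e'\<close> the total error is then at most t * (e / 2).\<close>
  define M where "M = 2 * norm v + norm w + 1"
  have "M > 0" unfolding M_def by (intro add_nonneg_pos add_nonneg_nonneg) auto
  define e' where "e' = e / (2 * M)"
  have "e' > 0" using \<open>e > 0\<close> \<open>M > 0\<close> by (simp add: e'_def)
  obtain r where "r > 0" and r: "ball z r \<subseteq> S"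
    using assms(1,2) open_contains_ball by blast
  interpret L: bounded_linear L using G has_derivative_bounded_linear by blast
  obtain d where "d > 0" and d: "\<And>y. norm (y - z) < d \<Longrightarrow>
      norm (u' y v - u' z v - L (y - z)) \<le> e' * norm (y - z)"
    using G \<open>e' > 0\<close> unfolding has_derivative_at_alt by blast
  \<comment> \<open>For t < k all points z + x v + y w with x and y in [0, t] lie both in the ball
    inside \<open>S\<close> and in the ball where the linearisation holds.\<close>
  define k where "k = min r d / M"
  have "k > 0" using \<open>r > 0\<close> \<open>d > 0\<close> \<open>M > 0\<close> by (simp add: k_def)
  have close: "norm (x *\<^sub>R v + y *\<^sub>R w) < min r d" if "0 \<le> x" "x \<le> t" "0 \<le> y" "y \<le> t" "t < k" for x y t
  proof -
    have "t \<ge> 0" using that by simp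
    have "norm (x *\<^sub>R v + y *\<^sub>R w) \<le> x * norm v + y * norm w"
      using norm_triangle_ineq[of "x *\<^sub>R v" "y *\<^sub>R w"] that by simp
    also have "\<dots> \<le> t * norm v + t * norm w"
      by (intro add_mono mult_right_mono that) auto
    also have "\<dots> \<le> t * M" unfolding M_def using \<open>t \<ge> 0\<close> by (simp add: algebra_simps)
    also have "\<dots> < k * M" using \<open>M > 0\<close> that by simp
    finally show ?thesis using \<open>M > 0\<close> by (simp add: k_def)
  qed
  have "dist ((u (z + t *\<^sub>R v + t *\<^sub>R w) - u (z + t *\<^sub>R v) - u (z + t *\<^sub>R w) + u z) / t\<^sup>2) (L w) < e"
    if t: "0 < t" "t < k" for t
  proof -
    \<comment> \<open>The second difference is \<open>\<phi> t - \<phi> 0\<close>.\<close>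
    define \<phi> where "\<phi> = (\<lambda>x. u (z + x *\<^sub>R v + t *\<^sub>R w) - u (z + x *\<^sub>R v))"
    have inS: "z + x *\<^sub>R v + y *\<^sub>R w \<in> S" if "0 \<le> x" "x \<le> t" "0 \<le> y" "y \<le> t" for x y
    proof -
      have "dist (z + (x *\<^sub>R v + y *\<^sub>R w)) z < r"
        using close[OF that \<open>t < k\<close>] by (simp only: dist_norm) simp
      thus ?thesis using r by (auto simp: add.assoc dist_commute)
    qed
    have lin: "(u has_derivative u' x) (at x)" "bounded_linear (u' x)" if "x \<in> S" for x
      using u[OF that] has_derivative_bounded_linear by auto
    have der: "(\<phi> has_real_derivative (u' (z + x *\<^sub>R v + t *\<^sub>R w) v - u' (z + x *\<^sub>R v) v)) (at x)"
      if "0 \<le> x" "x \<le> t" for x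
    proof -
      have *: "((\<lambda>x. u (z + x *\<^sub>R v + y *\<^sub>R w)) has_real_derivative u' (z + x *\<^sub>R v + y *\<^sub>R w) v) (at x)"
        if "0 \<le> y" "y \<le> t" for y
      proof -
        have P: "z + x *\<^sub>R v + y *\<^sub>R w \<in> S" using inS that \<open>0 \<le> x\<close> \<open>x \<le> t\<close> by blast
        interpret bounded_linear "u' (z + x *\<^sub>R v + y *\<^sub>R w)" by (rule lin(2)[OF P])
        have "((\<lambda>x. u (z + x *\<^sub>R v + y *\<^sub>R w)) has_derivative
                (\<lambda>h. u' (z + x *\<^sub>R v + y *\<^sub>R w) (h *\<^sub>R v))) (at x)"
          by (rule has_derivative_compose[where g = u and f = "\<lambda>x. z + x *\<^sub>R v + y *\<^sub>R w",
                OF _ lin(1)[OF P]]) (auto intro!: derivative_eq_intros)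
        thus ?thesis
          by (simp add: has_field_derivative_def scaleR mult.commute[of _ "u' _ _"])
      qed
      from DERIV_diff[OF *[of t] *[of 0]] show ?thesis unfolding \<phi>_def using t by simp
    qed
    obtain \<xi> where \<xi>: "0 < \<xi>" "\<xi> < t"
      and eq: "\<phi> t - \<phi> 0 = t * (u' (z + \<xi> *\<^sub>R v + t *\<^sub>R w) v - u' (z + \<xi> *\<^sub>R v) v)"
      using MVT2[OF \<open>0 < t\<close> der] by auto
    define A where "A = \<xi> *\<^sub>R v + t *\<^sub>R w"
    define B where "B = \<xi> *\<^sub>R v"
    have nA: "norm A < d" and nB: "norm B < d"
      using close[of \<xi> t t] close[of \<xi> t 0] \<xi> t by (auto simp: A_def B_def)
    have bA: "\<bar>u' (z + A) v - u' z v - L A\<bar> \<le> e' * norm A"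
      using d[of "z + A"] nA by simp
    have bB: "\<bar>u' (z + B) v - u' z v - L B\<bar> \<le> e' * norm B"
      using d[of "z + B"] nB by simp
    have "norm B \<le> t * norm v" using \<xi> by (auto simp: B_def intro: mult_right_mono)
    moreover have "norm A \<le> norm B + t * norm w"
      using norm_triangle_ineq[of "\<xi> *\<^sub>R v" "t *\<^sub>R w"] t by (simp add: A_def B_def)
    ultimately have "norm A + norm B \<le> t * M" using t by (simp add: M_def algebra_simps)
    hence "e' * norm A + e' * norm B \<le> e' * (t * M)"
      using \<open>e' > 0\<close> by (simp flip: distrib_left)
    also have "\<dots> = t * (e / 2)" using \<open>M > 0\<close> by (simp add: e'_def)
    finally have "\<bar>u' (z + A) v - u' (z + B) v - (L A - L B)\<bar> \<le> t * (e / 2)"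
      using bA bB by linarith
    \<comment> \<open>The unknown intermediate point \<xi> drops out here, because A - B = t
      w.\<close>
    moreover have "L A - L B = t * L w" by (simp add: A_def B_def L.add L.scaleR)
    moreover have "\<phi> t - \<phi> 0 = t * (u' (z + A) v - u' (z + B) v)"
      using eq by (simp add: A_def B_def add.assoc)
    ultimately have
      "\<bar>u' (z + A) v - u' (z + B) v - t * L w\<bar> \<le> t * (e / 2)"
      and "(\<phi> t - \<phi> 0) / t\<^sup>2 - L w = (u' (z + A) v - u' (z + B) v - t * L w) / t"
      using t by (simp_all add: power2_eq_square diff_divide_distrib)
    hence "\<bar>(\<phi> t - \<phi> 0) / t\<^sup>2 - L w\<bar> \<le> e / 2"
      using t by (simp add: abs_divide pos_divide_le_eq mult.commute)
    moreover have "u (z + t *\<^sub>R v + t *\<^sub>R w) - u (z + t *\<^sub>R v) - u (z + t *\<^sub>R w) + u z = \<phi> t - \<phi> 0"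
      by (simp add: \<phi>_def)
    ultimately show ?thesis using \<open>e > 0\<close> by (simp only: dist_real_def)
  qed
  thus "\<forall>\<^sub>F t in at_right 0. dist ((u (z + t *\<^sub>R v + t *\<^sub>R w) - u (z + t *\<^sub>R v) - u (z + t *\<^sub>R w) + u z) / t\<^sup>2) (L w) < e"
    unfolding eventually_at_right_field using \<open>k > 0\<close> by blast
qed

text \<open>The second difference is symmetric in \<open>v\<close> and \<open>w\<close>, so its
  limit can be computed in both orders.\<close>

lemma mixed_derivatives_eq:
  fixes u :: "'a::real_normed_vector \<Rightarrow> real"
  assumes "open S" "z \<in> S"
    and "\<And>x. x \<in> S \<Longrightarrow> (u has_derivative u' x) (at x)"
    and "((\<lambda>x. u' x v) has_derivative L) (at z)" "((\<lambda>x. u' x w) has_derivative M) (at z)"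
  shows "L w = M v"
proof -
  have swap: "z + t *\<^sub>R w + t *\<^sub>R v = z + t *\<^sub>R v + t *\<^sub>R w" for t
    by (simp only: add_ac)
  have L: "((\<lambda>t. (u (z + t *\<^sub>R v + t *\<^sub>R w) - u (z + t *\<^sub>R v) - u (z + t *\<^sub>R w) + u z) / t\<^sup>2)
            \<longlongrightarrow> L w) (at_right 0)"
    by (rule second_difference_tendsto[where u = u and u' = u', OF assms(1,2) _ assms(4)]) (rule assms(3))
  have "((\<lambda>t. (u (z + t *\<^sub>R w + t *\<^sub>R v) - u (z + t *\<^sub>R w) - u (z + t *\<^sub>R v) + u z) / t\<^sup>2)
            \<longlongrightarrow> M v) (at_right 0)"
    by (rule second_difference_tendsto[where u = u and u' = u', OF assms(1,2) _ assms(5)]) (rule assms(3))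
  hence "((\<lambda>t. (u (z + t *\<^sub>R v + t *\<^sub>R w) - u (z + t *\<^sub>R v) - u (z + t *\<^sub>R w) + u z) / t\<^sup>2)
            \<longlongrightarrow> M v) (at_right 0)"
    by (simp only: swap cancel_ab_semigroup_add_class.diff_right_commute)
  from tendsto_unique[OF trivial_limit_at_right_real L this] show ?thesis .
qed

subsection \<open>Real parts of holomorphic functions\<close>

lemma linear_complex_to_real:
  fixes L :: "complex \<Rightarrow> real"
  assumes "linear L"
  shows "L \<xi> = Re \<xi> * L 1 + Im \<xi> * L \<i>"
proof -
  have "L \<xi> = L (Re \<xi> *\<^sub>R 1 + Im \<xi> *\<^sub>R \<i>)"
    by (rule arg_cong[of _ _ L]) (simp add: complex_eq_iff)
  also have "\<dots> = Re \<xi> * L 1 + Im \<xi> * L \<i>"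
    by (simp only: linear_add[OF assms] linear_scale[OF assms] real_scaleR_def)
  finally show ?thesis .
qed

lemma C1_on_has_derivative:
  assumes "C1_on u S" "z \<in> S"
  shows "(u has_derivative (\<lambda>v. dir_deriv v u z)) (at z)"
  using assms by (simp add: C1_on_def dir_deriv_def frechet_derivative_works[symmetric])

lemma C1_on_linear: "C1_on u S \<Longrightarrow> z \<in> S \<Longrightarrow> linear (\<lambda>v. dir_deriv v u z)"
  by (rule has_derivative_linear[OF C1_on_has_derivative])

text \<open>The expected derivative \<open>g\<close> is written down first and shown to be
  holomorphic; convexity of \<open>S\<close> supplies a primitive. Its real part has the same
  gradient as \<open>u\<close>, hence differs from \<open>u\<close> by a constant, which is
  subtracted.\<close>

lemma harmonic_on_Re_holomorphic:
  assumes u: "harmonic_on u S" and S: "open S" "convex S"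
  obtains f where "f holomorphic_on S" "\<And>z. z \<in> S \<Longrightarrow> Re (f z) = u z"
proof -
  have C: "C1_on u S" "C1_on (dir_deriv 1 u) S" "C1_on (dir_deriv \<i> u) S"
    using u by (auto simp: harmonic_on_def C2_on_def)
  define g where "g z = Complex (dir_deriv 1 u z) (- dir_deriv \<i> u z)" for z
  have "(g has_field_derivative
      Complex (dir_deriv 1 (dir_deriv 1 u) z) (- dir_deriv 1 (dir_deriv \<i> u) z)) (at z)"
    (is "(g has_field_derivative ?g') _") if "z \<in> S" for z
  proof -
    have sym: "dir_deriv \<i> (dir_deriv 1 u) z = dir_deriv 1 (dir_deriv \<i> u) z"
      by (rule mixed_derivatives_eq[OF S(1) that C1_on_has_derivative[OF C(1)]])
         (auto intro: C1_on_has_derivative C that)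
    have lap: "dir_deriv \<i> (dir_deriv \<i> u) z = - dir_deriv 1 (dir_deriv 1 u) z"
      using u that by (auto simp: harmonic_on_def)
    have "(g has_derivative (\<lambda>v. of_real (dir_deriv v (dir_deriv 1 u) z)
             - \<i> * of_real (dir_deriv v (dir_deriv \<i> u) z))) (at z)"
      unfolding g_def Complex_eq
      by (auto intro!: derivative_eq_intros C1_on_has_derivative C that)
    \<comment> \<open>A real-linear map is determined by its values at 1 and \<i>;
      \<open>sym\<close> and \<open>lap\<close> are the Cauchy-Riemann equations that make this one
      multiplication by a complex number.\<close>
    also have "(\<lambda>v. of_real (dir_deriv v (dir_deriv 1 u) z)
             - \<i> * of_real (dir_deriv v (dir_deriv \<i> u) z)) = (*) ?g'"
      apply (rule ext)
      subgoal for v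
        using linear_complex_to_real[OF C1_on_linear[OF C(2) that], of v]
          linear_complex_to_real[OF C1_on_linear[OF C(3) that], of v] sym lap
        by (simp add: complex_eq_iff algebra_simps)
      done
    finally show ?thesis by (simp add: has_field_derivative_def)
  qed
  hence "g holomorphic_on S" using S(1) by (auto simp: holomorphic_on_open)
  then obtain f where f: "\<And>x. x \<in> S \<Longrightarrow> (f has_field_derivative g x) (at x within S)"
    using holomorphic_convex_primitive'[OF S(2,1)] by metis
  have "((\<lambda>z. Re (f z) - u z) has_derivative (\<lambda>_. 0)) (at z within S)" if "z \<in> S" for z
  proof -
    have "((\<lambda>z. Re (f z) - u z) has_derivative (\<lambda>v. Re (g z * v) - dir_deriv v u z)) (at z within S)"
      using f[OF that] has_derivative_at_withinI[OF C1_on_has_derivative[OF C(1) that]]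
      by (intro has_derivative_diff has_derivative_Re) (simp_all add: has_field_derivative_def)
    moreover have "Re (g z * v) = dir_deriv v u z" for v
      using linear_complex_to_real[OF C1_on_linear[OF C(1) that], of v] by (simp add: g_def)
    ultimately show ?thesis by simp
  qed
  then obtain c where c: "\<And>z. z \<in> S \<Longrightarrow> Re (f z) - u z = c"
    using has_derivative_zero_constant[OF S(2), of "\<lambda>z. Re (f z) - u z"] by metis
  have "f holomorphic_on S"
    unfolding holomorphic_on_def field_differentiable_def by (intro ballI) (rule exI, erule f)
  hence "(\<lambda>z. f z - of_real c) holomorphic_on S"
    by (intro holomorphic_on_diff holomorphic_on_const)
  moreover have "Re (f z - of_real c) = u z" if "z \<in> S" for z
    using c[OF that] by simp
  ultimately show thesis by (rule that)
qed

subsection \<open>The Schwarz--Pick inequality\<close>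

text \<open>The real axis is the perpendicular bisector of \<open>b\<close> and its mirror image.
  This makes (a - b) / (a - cnj b) a map of the half-plane into the unit disc.\<close>

lemma norm_diff_less_norm_diff_cnj:
  assumes "Im a > 0" "Im b > 0"
  shows "norm (a - b) < norm (a - cnj b)"
proof -
  have "(Im a - Im b)\<^sup>2 < (Im a + Im b)\<^sup>2"
    using mult_pos_pos[OF assms] by (simp add: power2_eq_square algebra_simps)
  thus ?thesis by (simp add: cmod_def)
qed

text \<open>A disc automorphism taking 0 to \<open>z\<close> before \<open>H\<close>, and a Cayley
  map taking \<open>H z\<close> to 0 after it, give a self-map \<open>K\<close> of the disc fixing
  0. The claim is the Schwarz bound for K'(0) written out by the chain rule.\<close>

lemma Schwarz_Pick_half_plane:
  assumes H: "H holomorphic_on ball 0 1" and pos: "\<And>z. norm z < 1 \<Longrightarrow> Im (H z) > 0"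
    and z: "norm z < 1"
  shows "norm (deriv H z) * (1 - (norm z)\<^sup>2) \<le> 2 * Im (H z)"
proof -
  \<comment> \<open>This is w |-> (w + z) / (1 + cnj z w), whose derivative at 0 is 1 - z cnj
    z.\<close>
  define \<phi> where "\<phi> = Moebius_function 0 (- z)"
  define K where "K w = (H (\<phi> w) - H z) / (H (\<phi> w) - cnj (H z))" for w
  have \<phi>_lt: "norm (\<phi> w) < 1" if "norm w < 1" for w
    using Moebius_function_norm_lt_1[of "- z" w 0] z that by (simp add: \<phi>_def)
  have \<phi>0: "\<phi> 0 = z" by (simp add: \<phi>_def Moebius_function_def)
  have nz: "H (\<phi> w) - cnj (H z) \<noteq> 0" if "norm w < 1" for w
    using pos[OF \<phi>_lt[OF that]] pos[OF z] by (auto simp: complex_eq_iff)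
  have \<phi>_hol: "\<phi> holomorphic_on ball 0 1"
    using Moebius_function_holomorphic[of "- z" 0] z by (simp add: \<phi>_def)
  have "(\<lambda>w. H (\<phi> w)) holomorphic_on ball 0 1"
    by (rule holomorphic_on_compose_gen[OF \<phi>_hol H, unfolded o_def]) (use \<phi>_lt in auto)
  hence K_hol: "K holomorphic_on ball 0 1"
    unfolding K_def using nz by (auto intro!: holomorphic_intros)
  have K_lt: "norm (K w) < 1" if "norm w < 1" for w
    using norm_diff_less_norm_diff_cnj[OF pos[OF \<phi>_lt[OF that]] pos[OF z]] nz[OF that]
    by (simp add: K_def norm_divide)
  have "K 0 = 0" by (simp add: K_def \<phi>0)
  hence "norm (deriv K 0) \<le> 1"
    using Schwarz_Lemma(2)[OF K_hol _ K_lt, of 0] by simp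
  moreover have z2: "(of_real (norm z))\<^sup>2 = z * cnj z"
    by (metis complex_norm_square of_real_power)
  have "(\<phi> has_field_derivative of_real (1 - (norm z)\<^sup>2)) (at 0)"
    unfolding \<phi>_def Moebius_function_def
    by (auto intro!: derivative_eq_intros simp: z2 algebra_simps)
  hence "((\<lambda>w. H (\<phi> w)) has_field_derivative deriv H z * of_real (1 - (norm z)\<^sup>2)) (at 0)"
    using holomorphic_derivI[OF H, of z] z DERIV_chain2[of H "deriv H z" \<phi> 0]
    by (simp add: \<phi>0)
  hence "(K has_field_derivative
            deriv H z * of_real (1 - (norm z)\<^sup>2) / (H z - cnj (H z))) (at 0)"
    unfolding K_def using nz[of 0]
    by (auto intro!: derivative_eq_intros simp: \<phi>0)
  hence "deriv K 0 = deriv H z * of_real (1 - (norm z)\<^sup>2) / (H z - cnj (H z))"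
    by (rule DERIV_imp_deriv)
  moreover have "norm (H z - cnj (H z)) = 2 * Im (H z)"
    using pos[OF z] by (simp add: complex_diff_cnj norm_mult)
  moreover have "\<bar>1 - (norm z)\<^sup>2\<bar> = 1 - (norm z)\<^sup>2"
    using z by (simp add: power_le_one)
  ultimately show ?thesis using pos[OF z]
    by (simp add: norm_divide norm_mult del: of_real_diff)
qed

lemma A_coeff_pos:
  assumes "\<alpha> < t" "t < \<beta>"
  shows "A_coeff \<alpha> \<beta> t > 0"
proof -
  have "sin (pi * (t - \<alpha>) / (\<beta> - \<alpha>)) > 0"
    using assms by (intro sin_gt_zero) (auto simp: field_simps)
  thus ?thesis using assms by (simp add: A_coeff_def)
qed

text \<open>With \<open>u = Re f\<close>, the map \<open>exp (\<i> \<pi> (f - \<alpha>) / (\<beta> - \<alpha>))\<close> takes the disc into the upper half-plane,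
  since its argument is \<open>\<pi> (u - \<alpha>) / (\<beta> - \<alpha>) \<in> (0, \<pi>)\<close>.\<close>

lemma harmonic_on_interval_bound:
  assumes u: "harmonic_on u (ball 0 1)" and rng: "\<And>z. norm z < 1 \<Longrightarrow> \<alpha> < u z \<and> u z < \<beta>"
    and z: "norm z < 1"
  shows "2 * \<bar>frechet_derivative u (at z) \<xi>\<bar> / A_coeff \<alpha> \<beta> (u z) \<le> 2 * norm \<xi> / (1 - (norm z)\<^sup>2)"
proof -
  obtain f where f: "f holomorphic_on ball 0 1" and Re_f: "\<And>z. z \<in> ball 0 1 \<Longrightarrow> Re (f z) = u z"
    using harmonic_on_Re_holomorphic[OF u] by auto
  define k where "k = pi / (\<beta> - \<alpha>)"
  have "k > 0" using rng[OF z] by (auto simp: k_def)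
  define H where "H w = exp (\<i> * of_real k * (f w - of_real \<alpha>))" for w
  have H_hol: "H holomorphic_on ball 0 1"
    unfolding H_def by (intro holomorphic_intros f)
  have Im_H: "Im (H w) = norm (H w) * sin (k * (u w - \<alpha>))" if "norm w < 1" for w
    using Re_f[of w] that by (simp add: H_def Im_exp)
  have sin_pos: "sin (k * (u w - \<alpha>)) > 0" if "norm w < 1" for w
    using rng[OF that] by (intro sin_gt_zero) (auto simp: k_def field_simps)
  have H_pos: "Im (H w) > 0" if "norm w < 1" for w
    unfolding Im_H[OF that] using sin_pos[OF that] by (simp add: H_def)
  have f_der: "(f has_field_derivative deriv f z) (at z)"
    using holomorphic_derivI[OF f] z by auto
  have "(H has_field_derivative H z * (\<i> * of_real k * deriv f z)) (at z)"
    unfolding H_def by (auto intro!: derivative_eq_intros f_der)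
  hence "deriv H z = H z * (\<i> * of_real k * deriv f z)" by (rule DERIV_imp_deriv)
  hence "norm (deriv H z) = norm (H z) * (k * norm (deriv f z))"
    using \<open>k > 0\<close> by (simp add: norm_mult)
  \<comment> \<open>Both sides carry the factor \<open>norm (H z)\<close>, positive because
    \<open>H\<close> is an exponential. Cancelling it leaves a bound in terms of f' and
    \<open>u\<close> only.\<close>
  hence "norm (H z) * (k * norm (deriv f z) * (1 - (norm z)\<^sup>2))
           \<le> norm (H z) * (2 * sin (k * (u z - \<alpha>)))"
    using Schwarz_Pick_half_plane[OF H_hol H_pos z] Im_H[OF z] by (simp add: mult_ac)
  hence main: "k * norm (deriv f z) * (1 - (norm z)\<^sup>2) \<le> 2 * sin (k * (u z - \<alpha>))"
    by (rule mult_left_le_imp_le) (simp add: H_def)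
  have "((\<lambda>w. Re (f w)) has_derivative (\<lambda>v. Re (deriv f z * v))) (at z)"
    using f_der by (intro has_derivative_Re) (simp add: has_field_derivative_def)
  hence "(u has_derivative (\<lambda>v. Re (deriv f z * v))) (at z)"
    by (rule has_derivative_transform_within_open[of _ _ _ _ "ball 0 1"]) (use z Re_f in auto)
  hence "frechet_derivative u (at z) \<xi> = Re (deriv f z * \<xi>)"
    using frechet_derivative_at by metis
  hence le: "\<bar>frechet_derivative u (at z) \<xi>\<bar> \<le> norm (deriv f z) * norm \<xi>"
    using abs_Re_le_cmod[of "deriv f z * \<xi>"] by (simp add: norm_mult)
  have z1: "1 - (norm z)\<^sup>2 > 0" using z by (simp add: power_less_one_iff abs_square_less_1)
  have A: "A_coeff \<alpha> \<beta> (u z) = 2 * sin (k * (u z - \<alpha>)) / k"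
    by (simp add: A_coeff_def k_def)
  have "\<bar>frechet_derivative u (at z) \<xi>\<bar> * (1 - (norm z)\<^sup>2)
          \<le> (norm (deriv f z) * norm \<xi>) * (1 - (norm z)\<^sup>2)"
    using le z1 by (intro mult_right_mono) auto
  also have "\<dots> = norm \<xi> * (k * norm (deriv f z) * (1 - (norm z)\<^sup>2) / k)"
    using \<open>k > 0\<close> by simp
  also have "\<dots> \<le> norm \<xi> * A_coeff \<alpha> \<beta> (u z)"
    unfolding A using main \<open>k > 0\<close> by (intro mult_left_mono divide_right_mono) auto
  finally show ?thesis
    using z1 A_coeff_pos[of \<alpha> "u z" \<beta>] rng[OF z] by (simp add: field_simps)
qed

section \<open>From a single component to the box metric\<close>

lemma harmonic_map_on_has_derivative:
  assumes "harmonic_map_on h S" "z \<in> S"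
  shows "(h has_derivative (\<lambda>v. \<chi> j. dir_deriv v (\<lambda>z. h z $ j) z)) (at z)"
proof -
  have "C1_on (\<lambda>z. h z $ j) S" for j
    using assms by (auto simp: harmonic_map_on_def harmonic_on_def C2_on_def)
  thus ?thesis
    unfolding has_derivative_componentwise_within[of h]
    by (auto simp: Basis_vec_def inner_axis intro: C1_on_has_derivative assms)
qed

lemma frechet_derivative_harmonic_map:
  assumes "harmonic_map_on h S" "z \<in> S"
  shows "frechet_derivative h (at z) \<xi> $ j = frechet_derivative (\<lambda>z. h z $ j) (at z) \<xi>"
  unfolding frechet_derivative_at[OF harmonic_map_on_has_derivative[OF assms], symmetric]
  by (simp add: dir_deriv_def)

lemma box_metric_le:
  fixes a b :: "real ^ 'n"
  assumes h: "harmonic_map_on h (ball 0 1)" and rng: "h ` ball 0 1 \<subseteq> box a b" and z: "z \<in> ball 0 1"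
  shows "box_metric a b (h z) (frechet_derivative h (at z) \<xi>) \<le> 2 * norm \<xi> / (1 - (norm z)\<^sup>2)"
  unfolding box_metric_def
proof (rule Max.boundedI)
  fix y assume "y \<in> range (\<lambda>j. 2 * \<bar>frechet_derivative h (at z) \<xi> $ j\<bar> / A_coeff (a $ j) (b $ j) (h z $ j))"
  then obtain j where
    y: "y = 2 * \<bar>frechet_derivative h (at z) \<xi> $ j\<bar> / A_coeff (a $ j) (b $ j) (h z $ j)"
    by auto
  have "a $ j < h w $ j \<and> h w $ j < b $ j" if "norm w < 1" for w
  proof -
    have "h w \<in> box a b" using rng that by auto
    thus ?thesis by (simp add: mem_box_cart)
  qed
  moreover have "harmonic_on (\<lambda>z. h z $ j) (ball 0 1)"
    using h by (simp add: harmonic_map_on_def)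
  ultimately show "y \<le> 2 * norm \<xi> / (1 - (norm z)\<^sup>2)"
    unfolding y frechet_derivative_harmonic_map[OF h z]
    using z by (intro harmonic_on_interval_bound) auto
qed auto

lemma box_metric_nonneg:
  fixes a b :: "real ^ 'n"
  assumes "p \<in> box a b"
  shows "0 \<le> box_metric a b p v"
proof -
  \<comment> \<open>The index type is nonempty, so any one nonnegative term bounds the maximum from
    below.\<close>
  fix j :: 'n
  have "A_coeff (a $ j) (b $ j) (p $ j) > 0"
    using assms by (intro A_coeff_pos) (auto simp: mem_box_cart)
  hence "0 \<le> 2 * \<bar>v $ j\<bar> / A_coeff (a $ j) (b $ j) (p $ j)" by simp
  also have "\<dots> \<le> box_metric a b p v" unfolding box_metric_def by (intro Max_ge) auto
  finally show ?thesis .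
qed

subsection \<open>Lengths of piecewise continuously differentiable curves\<close>

text \<open>Locates the piece of a partition that surrounds a parameter off it: its nearest
  neighbours in \<open>T\<close> on both sides, which exist by finiteness and because of
  \<open>p\<close> and \<open>q\<close>.\<close>

lemma consecutive_points:
  fixes T :: "'a::linorder set"
  assumes "finite T" "p \<in> T" "q \<in> T" "p \<le> x" "x \<le> q" "x \<notin> T"
  obtains s t where "s \<in> T" "t \<in> T" "s < x" "x < t" "T \<inter> {s<..<t} = {}"
proof
  have ne: "p \<in> T \<inter> {..<x}" "q \<in> T \<inter> {x<..}" using assms by (auto simp: order.order_iff_strict)
  have fin: "finite (T \<inter> {..<x})" "finite (T \<inter> {x<..})" using assms by auto
  have "Max (T \<inter> {..<x}) \<in> T \<inter> {..<x}" "Min (T \<inter> {x<..}) \<in> T \<inter> {x<..}"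
    using ne fin by (auto intro!: Max_in Min_in simp del: Int_iff)
  thus "Max (T \<inter> {..<x}) \<in> T" "Min (T \<inter> {x<..}) \<in> T" "Max (T \<inter> {..<x}) < x" "x < Min (T \<inter> {x<..})"
    by auto
  show "T \<inter> {Max (T \<inter> {..<x})<..<Min (T \<inter> {x<..})} = {}"
  proof (rule ccontr)
    assume "T \<inter> {Max (T \<inter> {..<x})<..<Min (T \<inter> {x<..})} \<noteq> {}"
    then obtain y where y: "y \<in> T" "Max (T \<inter> {..<x}) < y" "y < Min (T \<inter> {x<..})" by auto
    show False
    proof (cases "y < x")
      case True
      thus False using Max_ge[OF fin(1), of y] y by auto
    next
      case False
      hence "x < y" using y assms by (metis linorder_less_linear)
      thus False using Min_le[OF fin(2), of y] y by auto
    qed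
  qed
qed

text \<open>Induction on the number of partition points in [p, q): the piece from the predecessor
  \<open>s\<close> of \<open>q\<close> up to \<open>q\<close> is split off.\<close>

lemma integrable_on_partition:
  fixes f :: "real \<Rightarrow> 'a::banach"
  assumes "finite T" "p \<in> T"
    and f: "\<And>s t. s \<in> T \<Longrightarrow> t \<in> T \<Longrightarrow> s < t \<Longrightarrow> T \<inter> {s<..<t} = {} \<Longrightarrow> f integrable_on {s..t}"
    and "q \<in> T" "p \<le> q"
  shows "f integrable_on {p..q}"
  using assms(4,5)
proof (induction "card (T \<inter> {p..<q})" arbitrary: q rule: less_induct)
  case less
  show ?case
  proof (cases "p = q")
    case True
    thus ?thesis using integrable_on_refl[of f p] by simp
  next
    case False
    define s where "s = Max (T \<inter> {..<q})"
    have fin: "finite (T \<inter> {..<q})" using \<open>finite T\<close> by simp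
    have p: "p \<in> T \<inter> {..<q}" using False less.prems \<open>p \<in> T\<close> by auto
    have s: "s \<in> T" "s < q" using Max_in[OF fin] p unfolding s_def by blast+
    have "p \<le> s" using Max_ge[OF fin p] by (simp add: s_def)
    have empty: "T \<inter> {s<..<q} = {}" using Max_ge[OF fin] by (fastforce simp: s_def)
    \<comment> \<open>The half-open intervals make the count drop: \<open>s\<close> is counted for
      \<open>q\<close> but not for itself.\<close>
    have "T \<inter> {p..<s} \<subset> T \<inter> {p..<q}" using s \<open>p \<le> s\<close> by auto
    hence "card (T \<inter> {p..<s}) < card (T \<inter> {p..<q})"
      using \<open>finite T\<close> by (intro psubset_card_mono) auto
    hence "f integrable_on {p..s}" using less.hyps s \<open>p \<le> s\<close> by blast
    moreover have "f integrable_on {s..q}" using f s less.prems empty by blast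
    ultimately show ?thesis
      using \<open>p \<le> s\<close> s by (intro Henstock_Kurzweil_Integration.integrable_combine[of p s q f]) simp_all
  qed
qed

text \<open>Links the derivatives within closed pieces, which define the curves, to the two-sided
  derivative in \<open>curve_length\<close>.\<close>

lemma vector_derivative_interior:
  fixes \<gamma> :: "real \<Rightarrow> 'a::real_normed_vector"
  assumes "\<forall>x\<in>{s..t}. (\<gamma> has_vector_derivative D x) (at x within {s..t})" "s < x" "x < t"
  shows "(\<gamma> has_vector_derivative D x) (at x)" "vector_derivative \<gamma> (at x) = D x"
proof -
  have "(\<gamma> has_vector_derivative D x) (at x within {s..t})" using assms by auto
  thus "(\<gamma> has_vector_derivative D x) (at x)"
    using at_within_interior[of x "{s..t}"] assms by (simp add: interior_atLeastAtMost_real)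
  thus "vector_derivative \<gamma> (at x) = D x" by (rule vector_derivative_at)
qed

lemma piecewise_C1_curveE:
  assumes "piecewise_C1_curve \<gamma>"
  obtains T where "finite T" "0 \<in> T" "1 \<in> T" "T \<subseteq> {0..1}"
    and "\<forall>s\<in>T. \<forall>t\<in>T. s < t \<and> T \<inter> {s<..<t} = {} \<longrightarrow>
      (\<exists>D. continuous_on {s..t} D \<and> (\<forall>x\<in>{s..t}. (\<gamma> has_vector_derivative D x) (at x within {s..t})))"
proof -
  have "\<exists>T. finite T \<and> {0, 1} \<subseteq> T \<and> T \<subseteq> {0..1} \<and>
      (\<forall>s\<in>T. \<forall>t\<in>T. s < t \<and> T \<inter> {s<..<t} = {} \<longrightarrow>
         (\<exists>D. continuous_on {s..t} D \<and>
            (\<forall>x\<in>{s..t}. (\<gamma> has_vector_derivative D x) (at x within {s..t}))))"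
    using assms unfolding piecewise_C1_curve_def by (rule conjunct2)
  then obtain T where T: "finite T \<and> {0, 1} \<subseteq> T \<and> T \<subseteq> {0..1} \<and>
      (\<forall>s\<in>T. \<forall>t\<in>T. s < t \<and> T \<inter> {s<..<t} = {} \<longrightarrow>
         (\<exists>D. continuous_on {s..t} D \<and>
            (\<forall>x\<in>{s..t}. (\<gamma> has_vector_derivative D x) (at x within {s..t}))))" ..
  show thesis by (rule that[of T]) (use T in simp_all)
qed

lemma piecewise_C1_curve_has_vector_derivative:
  assumes "piecewise_C1_curve \<gamma>"
  obtains T where "finite T"
    "\<And>x. x \<in> {0..1} - T \<Longrightarrow> (\<gamma> has_vector_derivative vector_derivative \<gamma> (at x)) (at x)"
proof -
  obtain T where T: "finite T" "0 \<in> T" "1 \<in> T" "T \<subseteq> {0..1}"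
    and D: "\<forall>s\<in>T. \<forall>t\<in>T. s < t \<and> T \<inter> {s<..<t} = {} \<longrightarrow>
      (\<exists>D. continuous_on {s..t} D \<and> (\<forall>x\<in>{s..t}. (\<gamma> has_vector_derivative D x) (at x within {s..t})))"
    by (rule piecewise_C1_curveE[OF assms])
  have "(\<gamma> has_vector_derivative vector_derivative \<gamma> (at x)) (at x)" if x: "x \<in> {0..1} - T" for x
  proof -
    obtain s t where st: "s \<in> T" "t \<in> T" "s < x" "x < t" "T \<inter> {s<..<t} = {}"
      using consecutive_points[OF T(1-3), of x] x by auto
    have "\<exists>D. continuous_on {s..t} D \<and> (\<forall>x\<in>{s..t}. (\<gamma> has_vector_derivative D x) (at x within {s..t}))"
      using D st by simp
    then obtain D where
      "continuous_on {s..t} D \<and> (\<forall>x\<in>{s..t}. (\<gamma> has_vector_derivative D x) (at x within {s..t}))" ..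
    from vector_derivative_interior[OF conjunct2[OF this] st(3,4)] show ?thesis by simp
  qed
  with T(1) show thesis by (rule that)
qed

text \<open>On each closed piece the integrand agrees, except possibly at the end points, with F
  (\<gamma> x) (D x), which is continuous up to the ends and therefore integrable.\<close>

lemma piecewise_C1_curve_length_integrable:
  fixes F :: "'a::real_normed_vector \<Rightarrow> 'a \<Rightarrow> real"
  assumes \<gamma>: "piecewise_C1_curve \<gamma>" "path_image \<gamma> \<subseteq> S"
    and F: "continuous_on (S \<times> UNIV) (\<lambda>(p, v). F p v)"
  shows "(\<lambda>s. F (\<gamma> s) (vector_derivative \<gamma> (at s))) integrable_on {0..1}"
proof -
  obtain T where T: "finite T" "0 \<in> T" "1 \<in> T" "T \<subseteq> {0..1}"
    and D: "\<forall>s\<in>T. \<forall>t\<in>T. s < t \<and> T \<inter> {s<..<t} = {} \<longrightarrow>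
      (\<exists>D. continuous_on {s..t} D \<and> (\<forall>x\<in>{s..t}. (\<gamma> has_vector_derivative D x) (at x within {s..t})))"
    by (rule piecewise_C1_curveE[OF \<gamma>(1)])
  have cont: "continuous_on {0..1} \<gamma>" using \<gamma> by (simp add: piecewise_C1_curve_def)
  show ?thesis
  proof (rule integrable_on_partition[OF T(1,2) _ T(3)])
    fix s t assume st: "s \<in> T" "t \<in> T" "s < t" "T \<inter> {s<..<t} = {}"
    have "\<exists>D. continuous_on {s..t} D \<and> (\<forall>x\<in>{s..t}. (\<gamma> has_vector_derivative D x) (at x within {s..t}))"
      using D st by simp
    then obtain D where D: "continuous_on {s..t} D"
      "\<forall>x\<in>{s..t}. (\<gamma> has_vector_derivative D x) (at x within {s..t})"
      by (elim exE conjE)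
    have sub: "{s..t} \<subseteq> {0..1}" using st T by auto
    have "continuous_on {s..t} (\<lambda>x. (\<gamma> x, D x))"
      by (intro continuous_on_Pair D(1) continuous_on_subset[OF cont sub])
    moreover have "(\<lambda>x. (\<gamma> x, D x)) ` {s..t} \<subseteq> S \<times> UNIV"
      using \<gamma>(2) sub unfolding path_image_def by blast
    ultimately have "continuous_on {s..t} (\<lambda>x. (\<lambda>(p, v). F p v) (\<gamma> x, D x))"
      by (rule continuous_on_compose2[OF F])
    hence "(\<lambda>x. F (\<gamma> x) (D x)) integrable_on cbox s t"
      by (intro integrable_continuous) simp
    hence "(\<lambda>x. F (\<gamma> x) (vector_derivative \<gamma> (at x))) integrable_on cbox s t"
      by (rule integrable_spike_interior[rotated])
        (use vector_derivative_interior(2)[OF D(2)] in auto)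
    thus "(\<lambda>x. F (\<gamma> x) (vector_derivative \<gamma> (at x))) integrable_on {s..t}" by simp
  qed simp
qed

text \<open>Makes the image of a curve admissible for \<open>box_dist\<close>; the same partition
  serves, with the chain rule on each piece.\<close>

lemma piecewise_C1_curve_harmonic_image:
  assumes \<gamma>: "piecewise_C1_curve \<gamma>" "path_image \<gamma> \<subseteq> S" and h: "harmonic_map_on h S"
  shows "piecewise_C1_curve (h \<circ> \<gamma>)"
proof -
  obtain T where T: "finite T" "0 \<in> T" "1 \<in> T" "T \<subseteq> {0..1}"
    and D: "\<forall>s\<in>T. \<forall>t\<in>T. s < t \<and> T \<inter> {s<..<t} = {} \<longrightarrow>
      (\<exists>D. continuous_on {s..t} D \<and> (\<forall>x\<in>{s..t}. (\<gamma> has_vector_derivative D x) (at x within {s..t})))"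
    by (rule piecewise_C1_curveE[OF \<gamma>(1)])
  have cont: "continuous_on {0..1} \<gamma>" using \<gamma> by (simp add: piecewise_C1_curve_def)
  have in_S: "\<gamma> x \<in> S" if "x \<in> {0..1}" for x using \<gamma>(2) that unfolding path_image_def by blast
  have C: "C1_on (\<lambda>z. h z $ j) S" for j
    using h by (auto simp: harmonic_map_on_def harmonic_on_def C2_on_def)
  have "continuous_on S h"
    by (intro continuous_at_imp_continuous_on ballI
        has_derivative_continuous[OF harmonic_map_on_has_derivative[OF h]])
  hence "continuous_on (\<gamma> ` {0..1}) h"
    using \<gamma>(2) unfolding path_image_def by (rule continuous_on_subset)
  hence "continuous_on {0..1} (h \<circ> \<gamma>)"
    by (rule continuous_on_compose[OF cont])
  moreover have "\<forall>s\<in>T. \<forall>t\<in>T. s < t \<and> T \<inter> {s<..<t} = {} \<longrightarrow>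
      (\<exists>D. continuous_on {s..t} D \<and>
         (\<forall>x\<in>{s..t}. ((h \<circ> \<gamma>) has_vector_derivative D x) (at x within {s..t})))"
  proof (intro ballI impI)
    fix s t assume st: "s \<in> T" "t \<in> T" "s < t \<and> T \<inter> {s<..<t} = {}"
    have "\<exists>D. continuous_on {s..t} D \<and> (\<forall>x\<in>{s..t}. (\<gamma> has_vector_derivative D x) (at x within {s..t}))"
      using D st by simp
    then obtain D where D: "continuous_on {s..t} D"
      "\<forall>x\<in>{s..t}. (\<gamma> has_vector_derivative D x) (at x within {s..t})"
      by (elim exE conjE)
    have sub: "{s..t} \<subseteq> {0..1}" using st T by auto
    define E where "E x = (\<chi> j. dir_deriv (D x) (\<lambda>z. h z $ j) (\<gamma> x))" for x
    have "continuous_on {s..t} (\<lambda>x. dir_deriv (D x) (\<lambda>z. h z $ j) (\<gamma> x))" for j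
    proof -
      \<comment> \<open>\<open>C1_on\<close> gives continuity only in the fixed directions 1 and
        \<i>, while \<open>D x\<close> varies with \<open>x\<close>; so the derivative is expanded
        in Re (D x) and Im (D x).\<close>
      have "continuous_on {s..t} (\<lambda>x. dir_deriv v (\<lambda>z. h z $ j) (\<gamma> x))" if "v \<in> {1, \<i>}" for v
      proof (rule continuous_on_compose2[where f = \<gamma> and g = "dir_deriv v (\<lambda>z. h z $ j)"])
        show "continuous_on S (dir_deriv v (\<lambda>z. h z $ j))" using C[of j] that unfolding C1_on_def by blast
        show "continuous_on {s..t} \<gamma>" by (rule continuous_on_subset[OF cont sub])
        show "\<gamma> ` {s..t} \<subseteq> S" using in_S sub by blast
      qed
      hence "continuous_on {s..t} (\<lambda>x. Re (D x) * dir_deriv 1 (\<lambda>z. h z $ j) (\<gamma> x)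
               + Im (D x) * dir_deriv \<i> (\<lambda>z. h z $ j) (\<gamma> x))"
        by (intro continuous_on_add continuous_on_mult continuous_on_Re continuous_on_Im D(1)) simp_all
      moreover have "Re (D x) * dir_deriv 1 (\<lambda>z. h z $ j) (\<gamma> x)
          + Im (D x) * dir_deriv \<i> (\<lambda>z. h z $ j) (\<gamma> x) = dir_deriv (D x) (\<lambda>z. h z $ j) (\<gamma> x)"
        if "x \<in> {s..t}" for x
        by (rule linear_complex_to_real[OF C1_on_linear[OF C], symmetric])
          (rule in_S[OF subsetD[OF sub that]])
      ultimately show ?thesis by (rule continuous_on_eq)
    qed
    hence "continuous_on {s..t} E" unfolding E_def by (intro continuous_on_vec_lambda)
    moreover have "((h \<circ> \<gamma>) has_vector_derivative E x) (at x within {s..t})" if "x \<in> {s..t}" for x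
    proof -
      have dh: "(h has_derivative (\<lambda>v. \<chi> j. dir_deriv v (\<lambda>z. h z $ j) (\<gamma> x))) (at (\<gamma> x))"
        using harmonic_map_on_has_derivative[OF h in_S] that sub by blast
      have "((\<lambda>x. h (\<gamma> x)) has_derivative (\<lambda>k. \<chi> j. dir_deriv (k *\<^sub>R D x) (\<lambda>z. h z $ j) (\<gamma> x)))
              (at x within {s..t})"
        by (rule has_derivative_compose[where f = \<gamma> and g = h, OF _ dh])
          (use bspec[OF D(2) that] in \<open>simp add: has_vector_derivative_def\<close>)
      thus ?thesis
        using linear_scale[OF has_derivative_linear[OF dh]]
        by (simp add: has_vector_derivative_def E_def o_def)
    qed
    ultimately show "\<exists>D. continuous_on {s..t} D \<and>
        (\<forall>x\<in>{s..t}. ((h \<circ> \<gamma>) has_vector_derivative D x) (at x within {s..t}))"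
      by (intro exI[of _ E] conjI ballI)
  qed
  moreover have "{0, 1} \<subseteq> T" using T by simp
  ultimately show ?thesis
    unfolding piecewise_C1_curve_def using T(1,4) by (intro conjI exI[of _ T])
qed

lemma curve_length_nonneg:
  assumes "path_image \<gamma> \<subseteq> S" "\<And>p v. p \<in> S \<Longrightarrow> 0 \<le> F p v"
  shows "0 \<le> curve_length F \<gamma>"
  unfolding curve_length_def
  \<comment> \<open>In the non-integrable case the length is the default value 0.\<close>
  by (cases "(\<lambda>s. F (\<gamma> s) (vector_derivative \<gamma> (at s))) integrable_on {0..1}")
    (use assms in \<open>auto simp: not_integrable_integral path_image_def intro!: integral_nonneg\<close>)

section \<open>Comparison of lengths and of distances\<close>

lemma continuous_on_poincare_metric:
  "continuous_on (ball 0 1 \<times> UNIV) (\<lambda>(p, v). poincare_metric p v)"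
proof -
  have "1 - (norm p)\<^sup>2 \<noteq> 0" if "norm p < 1" for p :: complex
    using abs_square_less_1[of "norm p"] that by simp
  thus ?thesis
    unfolding poincare_metric_def case_prod_unfold by (intro continuous_intros) auto
qed

lemma poincare_metric_nonneg: "p \<in> ball 0 1 \<Longrightarrow> 0 \<le> poincare_metric p v"
  using abs_square_less_1[of "norm p"] by (simp add: poincare_metric_def)

text \<open>If the integrand on the left is not integrable, its length is 0 and the claim is
  nonnegativity of the Poincare length. Otherwise the infinitesimal inequality holds at all but
  finitely many parameters and is integrated.\<close>

lemma curve_length_harmonic_image_le:
  fixes a b :: "real ^ 'n"
  assumes h: "harmonic_map_on h (ball 0 1)" and rng: "h ` ball 0 1 \<subseteq> box a b"
    and \<gamma>: "piecewise_C1_curve \<gamma>" "path_image \<gamma> \<subseteq> ball 0 1"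
  shows "curve_length (box_metric a b) (h \<circ> \<gamma>) \<le> curve_length poincare_metric \<gamma>"
proof (cases "(\<lambda>s. box_metric a b ((h \<circ> \<gamma>) s) (vector_derivative (h \<circ> \<gamma>) (at s))) integrable_on {0..1}")
  case False
  thus ?thesis
    using curve_length_nonneg[OF \<gamma>(2), of poincare_metric] poincare_metric_nonneg
    by (simp add: curve_length_def not_integrable_integral)
next
  case True
  obtain T where T: "finite T"
    "\<And>x. x \<in> {0..1} - T \<Longrightarrow> (\<gamma> has_vector_derivative vector_derivative \<gamma> (at x)) (at x)"
    using piecewise_C1_curve_has_vector_derivative[OF \<gamma>(1)] by blast
  define f where "f s = (if s \<in> T then 0
    else box_metric a b ((h \<circ> \<gamma>) s) (vector_derivative (h \<circ> \<gamma>) (at s)))" for s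
  have "f s \<le> poincare_metric (\<gamma> s) (vector_derivative \<gamma> (at s))" if s: "s \<in> {0..1}" for s
  proof -
    have in_ball: "\<gamma> s \<in> ball 0 1" using \<gamma>(2) s unfolding path_image_def by blast
    show ?thesis
    proof (cases "s \<in> T")
      case True
      thus ?thesis using poincare_metric_nonneg[OF in_ball] by (simp add: f_def)
    next
      case False
      let ?v = "vector_derivative \<gamma> (at s)"
      note dh = harmonic_map_on_has_derivative[OF h in_ball]
      have "(h has_derivative frechet_derivative h (at (\<gamma> s))) (at (\<gamma> s))"
        by (rule frechet_derivative_works[THEN iffD1, OF differentiableI[OF dh]])
      moreover have "(\<gamma> has_vector_derivative ?v) (at s)" using T False s by auto
      ultimately have "((\<lambda>x. h (\<gamma> x)) has_derivative (\<lambda>k. frechet_derivative h (at (\<gamma> s)) (k *\<^sub>R ?v))) (at s)"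
        unfolding has_vector_derivative_def by (rule has_derivative_compose[rotated])
      hence "((h \<circ> \<gamma>) has_vector_derivative frechet_derivative h (at (\<gamma> s)) ?v) (at s)"
        using dh by (simp add: has_vector_derivative_def o_def linear_scale[OF linear_frechet_derivative[OF differentiableI]])
      hence "vector_derivative (h \<circ> \<gamma>) (at s) = frechet_derivative h (at (\<gamma> s)) ?v"
        by (rule vector_derivative_at)
      thus ?thesis
        using box_metric_le[OF h rng in_ball, of ?v] False by (simp add: f_def poincare_metric_def)
    qed
  qed
  moreover have "f integrable_on {0..1}"
    by (rule integrable_spike_finite[OF T(1) _ True]) (simp add: f_def)
  moreover note piecewise_C1_curve_length_integrable[OF \<gamma> continuous_on_poincare_metric]
  ultimately have "integral {0..1} f \<le> curve_length poincare_metric \<gamma>"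
    unfolding curve_length_def by (intro integral_le)
  moreover have "curve_length (box_metric a b) (h \<circ> \<gamma>) = integral {0..1} f"
    unfolding curve_length_def
    by (rule integral_spike[OF negligible_finite[OF T(1)]]) (simp add: f_def)
  ultimately show ?thesis by simp
qed

lemma piecewise_C1_curve_linepath: "piecewise_C1_curve (linepath x y)"
proof -
  have "(linepath x y has_vector_derivative y - x) (at u within A)" for u A
    by (rule has_vector_derivative_linepath_within)
  thus ?thesis
    unfolding piecewise_C1_curve_def
    by (intro conjI exI[of _ "{0, 1}"]) (auto intro: continuous_on_const)
qed

text \<open>\<open>h\<close> carries every competitor for the Poincare distance to a competitor in
  the box that is no longer, so the infima compare.\<close>

lemma box_dist_le:
  fixes a b :: "real ^ 'n"
  assumes h: "harmonic_map_on h (ball 0 1)" and rng: "h ` ball 0 1 \<subseteq> box a b"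
    and z: "z0 \<in> ball 0 1" "z1 \<in> ball 0 1"
  shows "box_dist a b (h z0) (h z1) \<le> poincare_dist z0 z1"
  unfolding box_dist_def poincare_dist_def path_distance_def
proof (rule cInf_mono)
  \<comment> \<open>The infimum on the right must range over a nonempty set; the segment is
    admissible as the disc is convex.\<close>
  have "path_image (linepath z0 z1) \<subseteq> ball 0 1"
    using z by (simp add: closed_segment_subset)
  hence "linepath z0 z1 \<in> {\<gamma>. piecewise_C1_curve \<gamma> \<and> path_image \<gamma> \<subseteq> ball 0 1 \<and>
          pathstart \<gamma> = z0 \<and> pathfinish \<gamma> = z1}"
    using piecewise_C1_curve_linepath[of z0 z1] by simp
  thus "curve_length poincare_metric ` {\<gamma>. piecewise_C1_curve \<gamma> \<and> path_image \<gamma> \<subseteq> ball 0 1 \<and>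
          pathstart \<gamma> = z0 \<and> pathfinish \<gamma> = z1} \<noteq> {}"
    by blast
  show "bdd_below (curve_length (box_metric a b) ` {\<gamma>. piecewise_C1_curve \<gamma> \<and> path_image \<gamma> \<subseteq> box a b \<and>
          pathstart \<gamma> = h z0 \<and> pathfinish \<gamma> = h z1})"
    by (rule bdd_belowI[of _ 0]) (auto intro: curve_length_nonneg box_metric_nonneg)
next
  fix l assume "l \<in> curve_length poincare_metric ` {\<gamma>. piecewise_C1_curve \<gamma> \<and>
    path_image \<gamma> \<subseteq> ball 0 1 \<and> pathstart \<gamma> = z0 \<and> pathfinish \<gamma> = z1}"
  then obtain \<gamma> where \<gamma>: "piecewise_C1_curve \<gamma>" "path_image \<gamma> \<subseteq> ball 0 1"
    "pathstart \<gamma> = z0" "pathfinish \<gamma> = z1" and l: "l = curve_length poincare_metric \<gamma>" by auto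
  have "path_image (h \<circ> \<gamma>) \<subseteq> box a b" using \<gamma>(2) rng unfolding path_image_compose by blast
  hence "h \<circ> \<gamma> \<in> {\<gamma>. piecewise_C1_curve \<gamma> \<and> path_image \<gamma> \<subseteq> box a b \<and>
          pathstart \<gamma> = h z0 \<and> pathfinish \<gamma> = h z1}"
    using piecewise_C1_curve_harmonic_image[OF \<gamma>(1,2) h] \<gamma>(3,4)
    by (simp add: pathstart_compose pathfinish_compose)
  thus "\<exists>k\<in>curve_length (box_metric a b) ` {\<gamma>. piecewise_C1_curve \<gamma> \<and> path_image \<gamma> \<subseteq> box a b \<and>
          pathstart \<gamma> = h z0 \<and> pathfinish \<gamma> = h z1}. k \<le> l"
    using curve_length_harmonic_image_le[OF h rng \<gamma>(1,2)] unfolding l by blast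
qed

subsection \<open>Sharpness\<close>

lemma Re_has_derivative:
  "(f has_field_derivative f') (at z) \<Longrightarrow> ((\<lambda>w. Re (f w)) has_derivative (\<lambda>v. Re (f' * v))) (at z)"
  by (intro has_derivative_Re) (simp add: has_field_derivative_def)

lemma dir_deriv_Re:
  "(f has_field_derivative f') (at z) \<Longrightarrow> dir_deriv v (\<lambda>w. Re (f w)) z = Re (f' * v)"
  unfolding dir_deriv_def by (subst frechet_derivative_at[OF Re_has_derivative, symmetric]) simp_all

lemma dir_deriv_cong:
  assumes "open S" "z \<in> S" "u differentiable (at z)" "\<And>w. w \<in> S \<Longrightarrow> u w = u' w"
  shows "dir_deriv v u' z = dir_deriv v u z"
  using frechet_derivative_transform_within_open[OF assms(3,1,2,4)] by (simp add: dir_deriv_def)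

lemma C1_on_cong:
  assumes "C1_on u S" "open S" "\<And>w. w \<in> S \<Longrightarrow> u w = u' w"
  shows "C1_on u' S"
proof -
  have d: "u differentiable (at z)" if "z \<in> S" for z using assms that by (simp add: C1_on_def)
  have "u' differentiable (at z)" if "z \<in> S" for z
    using d[OF that] assms that unfolding differentiable_def
    by (meson has_derivative_transform_within_open)
  moreover have "continuous_on S (dir_deriv v u')" if "v \<in> {1, \<i>}" for v
    by (rule continuous_on_eq[of _ "dir_deriv v u"])
      (use assms(1) that in \<open>auto simp: C1_on_def dir_deriv_cong[OF assms(2) _ d assms(3)]\<close>)
  ultimately show ?thesis by (simp add: C1_on_def)
qed

lemma C1_on_Re:
  assumes f: "f holomorphic_on S" and S: "open S"
  shows "C1_on (\<lambda>z. Re (f z)) S"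
proof -
  note d = holomorphic_derivI[OF f S]
  have "continuous_on S (dir_deriv v (\<lambda>z. Re (f z)))" for v
    by (rule continuous_on_eq[of _ "\<lambda>z. Re (deriv f z * v)"])
      (auto intro!: continuous_intros holomorphic_on_imp_continuous_on holomorphic_deriv f S
        simp: dir_deriv_Re[OF d])
  moreover have "(\<lambda>z. Re (f z)) differentiable (at z)" if "z \<in> S" for z
    using Re_has_derivative[OF d[OF that]] by (rule differentiableI)
  ultimately show ?thesis by (simp add: C1_on_def)
qed

text \<open>A directional derivative of Re f is Re (f' v), again the real part of a holomorphic
  function, so the first-order results apply twice. The second derivative along \<open>v\<close> is
  Re (f'' v v), and the Laplacian vanishes because 1 + \<i> \<i> = 0.\<close>

lemma harmonic_on_Re:
  assumes f: "f holomorphic_on S" and S: "open S"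
  shows "harmonic_on (\<lambda>z. Re (f z)) S"
proof -
  note d = holomorphic_derivI[OF f S]
  have f': "(\<lambda>z. deriv f z * v) holomorphic_on S" for v
    by (intro holomorphic_intros f S)
  have eq: "Re (deriv f z * v) = dir_deriv v (\<lambda>z. Re (f z)) z" if "z \<in> S" for z v
    using dir_deriv_Re[OF d[OF that]] by simp
  have C1: "C1_on (dir_deriv v (\<lambda>z. Re (f z))) S" for v
    by (rule C1_on_cong[OF C1_on_Re[OF f' S] S eq])
  have "dir_deriv v (dir_deriv v (\<lambda>z. Re (f z))) z = Re (deriv (deriv f) z * v * v)"
    if "z \<in> S" for v z
  proof -
    have "(deriv f has_field_derivative deriv (deriv f) z) (at z)"
      using holomorphic_derivI[OF holomorphic_deriv[OF f S] S that] .
    hence *: "((\<lambda>z. deriv f z * v) has_field_derivative deriv (deriv f) z * v) (at z)"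
      by (rule DERIV_cmult_right)
    have "dir_deriv v (dir_deriv v (\<lambda>z. Re (f z))) z = dir_deriv v (\<lambda>z. Re (deriv f z * v)) z"
      by (rule dir_deriv_cong[OF S that differentiableI[OF Re_has_derivative[OF *]] eq])
    thus ?thesis using dir_deriv_Re[OF *] by simp
  qed
  thus ?thesis using C1 C1_on_Re[OF f S] by (simp add: harmonic_on_def C2_on_def)
qed

text \<open>The extremal map has as each component the real part of a conformal map onto a vertical strip.\<close>

lemma box_metric_sharp:
  fixes a b :: "real ^ 'n"
  assumes ab: "\<forall>j. a $ j < b $ j"
  obtains h where "harmonic_map_on h (ball 0 1)" "h ` ball 0 1 \<subseteq> box a b"
    "box_metric a b (h 0) (frechet_derivative h (at 0) \<i>) = 2"
proof -
  \<comment> \<open>The Cayley map sends the disc to the right half-plane and \<open>Ln\<close>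
    sends that to the strip |Im| < pi / 2. The factor -\<i> (b - a) / pi turns and scales it to |Re|
    < (b - a) / 2, and the constant moves it to the midpoint of the interval.\<close>
  define f where "f j z = of_real ((a $ j + b $ j) / 2)
      - \<i> * of_real ((b $ j - a $ j) / pi) * Ln ((1 + z) / (1 - z))" for j :: 'n and z
  define h where "h z = (\<chi> j. Re (f j z))" for z
  have Re_pos: "Re ((1 + z) / (1 - z)) > 0" if "norm z < 1" for z
  proof -
    have "Re ((1 + z) / (1 - z)) = (1 - (norm z)\<^sup>2) / (norm (1 - z))\<^sup>2"
      unfolding Re_divide cmod_power2 by (simp add: power2_eq_square algebra_simps)
    moreover have "norm (1 - z) > 0" using that by auto
    moreover have "(norm z)\<^sup>2 < 1" using that by (simp add: abs_square_less_1)
    ultimately show ?thesis by simp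
  qed
  have nz: "1 - z \<noteq> 0" if "norm z < 1" for z :: complex using that by auto
  have f_hol: "f j holomorphic_on ball 0 1" for j
    unfolding f_def
    by (intro holomorphic_intros) (use Re_pos nz in \<open>force simp: complex_nonpos_Reals_iff\<close>)+
  have harm: "harmonic_map_on h (ball 0 1)"
    using harmonic_on_Re[OF f_hol] by (simp add: harmonic_map_on_def h_def)
  have "a $ j < Re (f j z) \<and> Re (f j z) < b $ j" if "norm z < 1" for j z
  proof -
    define y where "y = Im (Ln ((1 + z) / (1 - z)))"
    define t where "t = (b $ j - a $ j) * (y / pi)"
    have "\<bar>y\<bar> < pi / 2"
      using Re_pos[OF that] Re_Ln_pos_lt[of "(1 + z) / (1 - z)"] unfolding y_def
      by (metis less_irrefl zero_complex.simps(1))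
    hence "\<bar>y / pi\<bar> < 1 / 2" by (simp add: field_simps)
    hence "(b $ j - a $ j) * \<bar>y / pi\<bar> < (b $ j - a $ j) * (1 / 2)"
      using ab by (intro mult_strict_left_mono) auto
    hence "\<bar>t\<bar> < (b $ j - a $ j) / 2"
      using ab by (simp add: t_def abs_mult less_imp_le)
    hence "t < (b $ j - a $ j) / 2" "- t < (b $ j - a $ j) / 2"
      unfolding abs_less_iff by simp_all
    moreover have "Re (f j z) = (a $ j + b $ j) / 2 + t"
      by (simp add: f_def y_def t_def)
    ultimately show ?thesis by (simp add: field_simps)
  qed
  hence rng: "h ` ball 0 1 \<subseteq> box a b" by (auto simp: mem_box_cart h_def)
  have "2 * \<bar>frechet_derivative h (at 0) \<i> $ j\<bar> / A_coeff (a $ j) (b $ j) (h 0 $ j) = 2" for j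
  proof -
    \<comment> \<open>The derivative at 0 is purely imaginary, so the direction \<i> makes f' \<xi>
      real and no length is lost in the real part.\<close>
    have "(f j has_field_derivative - \<i> * of_real ((b $ j - a $ j) / pi) * 2) (at 0)"
      unfolding f_def by (auto intro!: derivative_eq_intros)
    hence "frechet_derivative h (at 0) \<i> $ j = 2 * (b $ j - a $ j) / pi"
      using dir_deriv_Re[of "f j" _ 0 \<i>] frechet_derivative_harmonic_map[OF harm, of 0 \<i> j]
      by (simp add: h_def dir_deriv_def)
    \<comment> \<open>The origin goes to the midpoint, where the sine is 1; the component of the
      derivative then equals \<open>A_coeff\<close>, so every index contributes 2.\<close>
    moreover have "A_coeff (a $ j) (b $ j) (h 0 $ j) = 2 * (b $ j - a $ j) / pi"
    proof -
      have "pi * (h 0 $ j - a $ j) / (b $ j - a $ j) = pi / 2"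
        using ab[rule_format, of j] by (simp add: h_def f_def field_simps)
      hence "sin (pi * (h 0 $ j - a $ j) / (b $ j - a $ j)) = 1" by (simp only: sin_pi_half)
      thus ?thesis by (simp add: A_coeff_def)
    qed
    moreover have "2 * (b $ j - a $ j) / pi > 0" using ab by simp
    moreover have "2 * \<bar>x\<bar> / x = 2" if "x > 0" for x :: real using that by simp
    ultimately show ?thesis by (simp only:)
  qed
  hence "box_metric a b (h 0) (frechet_derivative h (at 0) \<i>) = 2"
    by (simp add: box_metric_def)
  with harm rng show thesis by (rule that)
qed

theorem theorem9p1:
  fixes a b :: "real ^ 'n"
  assumes "\<forall>j. a $ j < b $ j"
  shows "(\<forall>h. harmonic_map_on h (ball 0 1) \<and> h ` ball 0 1 \<subseteq> box a b \<longrightarrow>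
            (\<forall>z\<in>ball 0 1. \<forall>\<xi>. box_metric a b (h z) (frechet_derivative h (at z) \<xi>)
                                \<le> 2 * norm \<xi> / (1 - (norm z)\<^sup>2)) \<and>
            (\<forall>z0\<in>ball 0 1. \<forall>z1\<in>ball 0 1. box_dist a b (h z0) (h z1) \<le> poincare_dist z0 z1))
       \<and> (\<forall>c<1. \<not> (\<forall>h. harmonic_map_on h (ball 0 1) \<and> h ` ball 0 1 \<subseteq> box a b \<longrightarrow>
            (\<forall>z\<in>ball 0 1. \<forall>\<xi>. box_metric a b (h z) (frechet_derivative h (at z) \<xi>)
                                \<le> c * (2 * norm \<xi> / (1 - (norm z)\<^sup>2)))))"
proof (intro conjI allI impI notI)
  fix h :: "complex \<Rightarrow> real ^ 'n"
  assume h: "harmonic_map_on h (ball 0 1) \<and> h ` ball 0 1 \<subseteq> box a b"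
  show "\<forall>z\<in>ball 0 1. \<forall>\<xi>. box_metric a b (h z) (frechet_derivative h (at z) \<xi>)
          \<le> 2 * norm \<xi> / (1 - (norm z)\<^sup>2)"
    by (intro ballI allI box_metric_le[OF conjunct1[OF h] conjunct2[OF h]])
  show "\<forall>z0\<in>ball 0 1. \<forall>z1\<in>ball 0 1. box_dist a b (h z0) (h z1) \<le> poincare_dist z0 z1"
    by (intro ballI box_dist_le[OF conjunct1[OF h] conjunct2[OF h]])
next
  fix c :: real
  assume "c < 1" and c: "\<forall>h. harmonic_map_on h (ball 0 1) \<and> h ` ball 0 1 \<subseteq> box a b \<longrightarrow>
    (\<forall>z\<in>ball 0 1. \<forall>\<xi>. box_metric a b (h z) (frechet_derivative h (at z) \<xi>)
                         \<le> c * (2 * norm \<xi> / (1 - (norm z)\<^sup>2)))"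
  obtain h where h: "harmonic_map_on h (ball 0 1)" "h ` ball 0 1 \<subseteq> box a b"
    "box_metric a b (h 0) (frechet_derivative h (at 0) \<i>) = 2"
    by (rule box_metric_sharp[OF assms])
  \<comment> \<open>For the extremal map this reads 2 <= 2 c.\<close>
  have "box_metric a b (h 0) (frechet_derivative h (at 0) \<i>)
      \<le> c * (2 * norm \<i> / (1 - (norm (0::complex))\<^sup>2))"
    by (rule c[rule_format, OF conjI[OF h(1,2)]]) simp
  with h(3) \<open>c < 1\<close> show False by simp
qed

end
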